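(* If $F_t=\{t f_i(x)+q_i : 1\le i\le N\}$ is a one-parameter affine family on $\mathbb{R}^d$, then there is a real number $\tau>0$ such that the attractor $A_t$ of $F_t$ has empty interior for $t\in(0,\tau)$.
   Context: A function $f:\mathbb{R}^d\to\mathbb{R}^d$ is affine if $f(x)=Lx+a$, where $L$ is a non-singular $d\times d$ real matrix (the linear part of $f$) and $a\in\mathbb{R}^d$. A one-parameter affine family is given by $N\ge 2$ affine functions $F=\{f_1,\dots,f_N\}$ on $\mathbb{R}^d$ and vectors $q_1,\dots,q_N\in\mathbb{R}^d$; for each real $t\ge 0$ it is $F_t=\{t f_i(x)+q_i : 1\le i\le N\}$. The Hutchinson operator of $F_t$ on non-empty compact sets is $F_t(K)=\bigcup_{f\in F_t} f(K)$. A non-empty compact set $A_t$ is the attractor of $F_t$ if $A_t=\lim_{k\to\infty}F_t^k(K)$ in the Hausdorff metric for every non-empty compact $K$. If $L_1,\dots,L_N$ are the linear parts of $f_1,\dots,f_N$, the joint spectral radius of $F$ is $\rho(F)=\limsup_{k\to\infty}\big(\max\|L_{i_1}\cdots L_{i_k}\|\big)^{1/k}$, the maximum being over all words of length $k$ in $\{1,\dots,N\}$. Set $t_0=1/\rho(F)$; the attractor $A_t$ exists exactly for $t\in[0,t_0)$. *)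

theory Defs
  imports "HOL-Analysis.Analysis"
begin

definition affine_map :: "(real ^ 'd \<Rightarrow> real ^ 'd) \<Rightarrow> bool" where
  "affine_map f \<longleftrightarrow>
     (\<exists>(L :: real ^ 'd ^ 'd) (a :: real ^ 'd). invertible L \<and> (\<forall>x. f x = L *v x + a))"

definition affine_family ::
  "nat \<Rightarrow> (nat \<Rightarrow> real ^ 'd \<Rightarrow> real ^ 'd) \<Rightarrow> (nat \<Rightarrow> real ^ 'd) \<Rightarrow> real \<Rightarrow> (real ^ 'd \<Rightarrow> real ^ 'd) set"
where
  "affine_family N f q t = {(\<lambda>x. t *\<^sub>R f i x + q i) | i. i \<in> {1..N}}"

definition hutchinson :: "('a \<Rightarrow> 'a) set \<Rightarrow> 'a set \<Rightarrow> 'a set" where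
  "hutchinson G K = (\<Union>g\<in>G. g ` K)"

(* Meaningful only for non-empty compact arguments, on which both suprema are over
   non-empty bounded sets of reals. *)
definition hausdorff_dist :: "'a::metric_space set \<Rightarrow> 'a set \<Rightarrow> real" where
  "hausdorff_dist A B = max (SUP a\<in>A. infdist a B) (SUP b\<in>B. infdist b A)"

definition is_attractor :: "('a::metric_space \<Rightarrow> 'a) set \<Rightarrow> 'a set \<Rightarrow> bool" where
  "is_attractor G A \<longleftrightarrow>
     compact A \<and> A \<noteq> {} \<and>
     (\<forall>K. compact K \<and> K \<noteq> {} \<longrightarrow>
        (\<lambda>k. hausdorff_dist ((hutchinson G ^^ k) K) A) \<longlonglongrightarrow> 0)"

end

theory Submission
  imports Defs
begin

text \<open>
  For small \<open>t\<close> the maps of the system \<open>G\<close> are contractions with a common constant \<open>c\<close>,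
  proportional to \<open>t\<close>. Then \<open>k\<close> Hutchinson steps turn a ball into a set covered by
  \<open>card G ^ k\<close> balls whose radii have shrunk by \<open>c ^ k\<close>, so its volume is at most a constant
  times \<open>(card G * c ^ d) ^ k\<close>, where \<open>d\<close> is the dimension. This tends to \<open>0\<close> once
  \<open>card G * c ^ d < 1\<close>. (For similarities of ratio \<open>c\<close>, with \<open>0 < c < 1\<close>, this says that
  the similarity dimension of the system is below \<open>d\<close>.)

  A ball \<open>B\<close> that is large enough satisfies \<open>hutchinson G B \<subseteq> B\<close>
  (\<open>contraction_trapping_ball\<close>). Any attractor is the limit of the decreasing sequence of
  compact sets \<open>(hutchinson G ^^ k) B\<close> and therefore lies in each of them
  (\<open>attractor_subset_iterate\<close>). So it is a null set and cannot contain a non-empty open set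
  (\<open>attractor_empty_interior\<close>). The intersection of the same sequence is an attractor
  (\<open>contractive_attractor_exists\<close>), so that the assertion about attractors is not vacuous.
\<close>

section \<open>Iterates of the Hutchinson operator\<close>

lemma hutchinson_mono: "K \<subseteq> L \<Longrightarrow> hutchinson G K \<subseteq> hutchinson G L"
  unfolding hutchinson_def by blast

lemma hutchinson_nonempty: "G \<noteq> {} \<Longrightarrow> K \<noteq> {} \<Longrightarrow> hutchinson G K \<noteq> {}"
  unfolding hutchinson_def by blast

lemma compact_hutchinson:
  assumes "finite G" and "\<And>g. g \<in> G \<Longrightarrow> continuous_on UNIV g" and "compact K"
  shows "compact (hutchinson G K)"
  unfolding hutchinson_def
  by (rule compact_UN)
     (use assms in \<open>auto intro: compact_continuous_image continuous_on_subset\<close>)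

lemma iterate_hutchinson_mono:
  "K \<subseteq> L \<Longrightarrow> (hutchinson G ^^ k) K \<subseteq> (hutchinson G ^^ k) L"
  by (induction k) (auto dest: hutchinson_mono)

lemma iterate_hutchinson_nonempty:
  "G \<noteq> {} \<Longrightarrow> K \<noteq> {} \<Longrightarrow> (hutchinson G ^^ k) K \<noteq> {}"
  by (induction k) (auto simp: hutchinson_nonempty)

lemma compact_iterate_hutchinson:
  assumes "finite G" and "\<And>g. g \<in> G \<Longrightarrow> continuous_on UNIV g" and "compact K"
  shows "compact ((hutchinson G ^^ k) K)"
  using assms by (induction k) (auto intro: compact_hutchinson)

lemma iterate_hutchinson_subset_self:
  assumes "hutchinson G K \<subseteq> K"
  shows "(hutchinson G ^^ k) K \<subseteq> K"
proof (induction k)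
  case (Suc k)
  then show ?case using assms hutchinson_mono[of "(hutchinson G ^^ k) K" K G] by auto
qed simp

lemma iterate_hutchinson_decreasing:
  assumes "hutchinson G K \<subseteq> K" and "m \<le> n"
  shows "(hutchinson G ^^ n) K \<subseteq> (hutchinson G ^^ m) K"
proof -
  have "(hutchinson G ^^ n) K = (hutchinson G ^^ m) ((hutchinson G ^^ (n - m)) K)"
    using assms(2) funpow_add[of m "n - m" "hutchinson G"] by simp
  then show ?thesis
    using iterate_hutchinson_mono[OF iterate_hutchinson_subset_self[OF assms(1)]] by simp
qed

text \<open>
  A point of the \<open>k\<close>-th iterate of \<open>K\<close> is the image of a point of \<open>K\<close> under a word of length
  \<open>k\<close> in the maps; applying the same word to a point of \<open>L\<close> gives the partner, because the
  word contracts distances by \<open>c ^ k\<close>.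
\<close>

lemma iterate_hutchinson_close:
  fixes G :: "('a::metric_space \<Rightarrow> 'a) set"
  assumes lip: "\<And>g. g \<in> G \<Longrightarrow> c-lipschitz_on UNIV g"
    and "0 \<le> c" and "L \<noteq> {}"
    and D: "\<And>a b. a \<in> K \<Longrightarrow> b \<in> L \<Longrightarrow> dist a b \<le> D"
    and "x \<in> (hutchinson G ^^ k) K"
  shows "\<exists>y \<in> (hutchinson G ^^ k) L. dist x y \<le> c ^ k * D"
  using assms(5)
proof (induction k arbitrary: x)
  case 0
  then show ?case using \<open>L \<noteq> {}\<close> D by force
next
  case (Suc k)
  then have "x \<in> hutchinson G ((hutchinson G ^^ k) K)" by simp
  then obtain g x' where g: "g \<in> G" "x = g x'" and x': "x' \<in> (hutchinson G ^^ k) K"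
    unfolding hutchinson_def[of G "(hutchinson G ^^ k) K"] by blast
  from Suc.IH[OF x'] obtain y' where y': "y' \<in> (hutchinson G ^^ k) L" "dist x' y' \<le> c ^ k * D"
    by blast
  have "g y' \<in> (hutchinson G ^^ Suc k) L"
    using y'(1) g(1) by (auto simp: hutchinson_def[of G "(hutchinson G ^^ k) L"])
  moreover have "dist (g x') (g y') \<le> c * dist x' y'"
    using lip[OF g(1)] by (auto simp: lipschitz_on_def)
  then have "dist x (g y') \<le> c ^ Suc k * D"
    using mult_left_mono[OF y'(2) \<open>0 \<le> c\<close>] g(2) by (simp add: mult.assoc)
  ultimately show ?case by blast
qed

section \<open>Attractors and trapped compact sets\<close>

lemma hausdorff_dist_bounded:
  assumes "A \<noteq> {}" "B \<noteq> {}"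
    and A: "\<And>a. a \<in> A \<Longrightarrow> infdist a B \<le> e" and B: "\<And>b. b \<in> B \<Longrightarrow> infdist b A \<le> e"
  shows "0 \<le> hausdorff_dist A B" and "hausdorff_dist A B \<le> e"
proof -
  obtain a where "a \<in> A" using assms(1) by blast
  have "0 \<le> infdist a B" by (rule infdist_nonneg)
  also have "\<dots> \<le> (SUP a\<in>A. infdist a B)"
    by (rule cSUP_upper[OF \<open>a \<in> A\<close>]) (use A in \<open>auto simp: bdd_above_def\<close>)
  finally show "0 \<le> hausdorff_dist A B"
    unfolding hausdorff_dist_def by simp
  show "hausdorff_dist A B \<le> e"
    unfolding hausdorff_dist_def using assms by (auto intro: cSUP_least)
qed

lemma infdist_le_hausdorff_dist:
  assumes "compact B" and "b \<in> B"
  shows "infdist b A \<le> hausdorff_dist A B"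
proof -
  have "compact ((\<lambda>b. infdist b A) ` B)"
    by (intro compact_continuous_image assms(1) continuous_intros)
  then have "bdd_above ((\<lambda>b. infdist b A) ` B)"
    by (intro bounded_imp_bdd_above compact_imp_bounded)
  from cSUP_upper[OF assms(2) this] show ?thesis
    unfolding hausdorff_dist_def by simp
qed

text \<open>
  A point of the attractor is approximated by points of all later iterates of \<open>B\<close>. These
  lie in the \<open>k\<close>-th iterate, which is closed.
\<close>

lemma attractor_subset_iterate:
  fixes G :: "('a::metric_space \<Rightarrow> 'a) set"
  assumes attr: "is_attractor G A"
    and G: "finite G" "G \<noteq> {}" "\<And>g. g \<in> G \<Longrightarrow> continuous_on UNIV g"
    and B: "compact B" "B \<noteq> {}" "hutchinson G B \<subseteq> B"
  shows "A \<subseteq> (hutchinson G ^^ k) B"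
proof
  fix a assume "a \<in> A"
  let ?H = "\<lambda>k. (hutchinson G ^^ k) B"
  have ne: "?H n \<noteq> {}" for n by (rule iterate_hutchinson_nonempty[OF G(2) B(2)])
  have "infdist a (?H k) \<le> hausdorff_dist (?H n) A" if "k \<le> n" for n
  proof -
    have "infdist a (?H k) \<le> infdist a (?H n)"
      by (rule infdist_mono[OF iterate_hutchinson_decreasing[OF B(3) that] ne])
    also have "\<dots> \<le> hausdorff_dist (?H n) A"
      using attr \<open>a \<in> A\<close> by (intro infdist_le_hausdorff_dist) (auto simp: is_attractor_def)
    finally show ?thesis .
  qed
  moreover have "(\<lambda>n. hausdorff_dist (?H n) A) \<longlonglongrightarrow> 0"
    using attr B(1,2) unfolding is_attractor_def by blast
  ultimately have "infdist a (?H k) \<le> 0"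
    by (intro LIMSEQ_le_const) auto
  then have "infdist a (?H k) = 0"
    using infdist_nonneg[of a "?H k"] by linarith
  moreover have "closed (?H k)"
    by (intro compact_imp_closed compact_iterate_hutchinson G B)
  ultimately show "a \<in> ?H k"
    using in_closed_iff_infdist_zero[OF _ ne] by blast
qed

section \<open>Existence of the attractor of a contractive system\<close>

lemma contraction_trapping_ball:
  fixes G :: "('a::metric_space \<Rightarrow> 'a) set"
  assumes "finite G" and lip: "\<And>g. g \<in> G \<Longrightarrow> c-lipschitz_on UNIV g"
    and "0 \<le> c" "c < 1"
  obtains r where "0 \<le> r" and "hutchinson G (cball x r) \<subseteq> cball x r"
proof -
  \<comment> \<open>\<open>M\<close> bounds how far the maps move \<open>x\<close>; the radius solves \<open>M + c * r = r\<close>.\<close>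
  define M where "M = (\<Sum>g\<in>G. dist x (g x))"
  define r where "r = M / (1 - c)"
  have M: "dist x (g x) \<le> M" if "g \<in> G" for g
    unfolding M_def using \<open>finite G\<close> that by (intro member_le_sum) auto
  have "0 \<le> M" unfolding M_def by (intro sum_nonneg) simp
  have r: "0 \<le> r" "M + c * r = r"
    using \<open>0 \<le> M\<close> \<open>c < 1\<close> unfolding r_def by (auto simp: field_simps)
  have "dist x (g y) \<le> r" if "g \<in> G" "dist x y \<le> r" for g y
  proof -
    have "dist x (g y) \<le> dist x (g x) + dist (g x) (g y)" by (rule dist_triangle)
    also have "dist (g x) (g y) \<le> c * dist x y"
      using lip[OF that(1)] by (auto simp: lipschitz_on_def)
    also have "c * dist x y \<le> c * r" using that(2) \<open>0 \<le> c\<close> by (rule mult_left_mono)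
    finally show ?thesis using M[OF that(1)] r(2) by linarith
  qed
  then have "hutchinson G (cball x r) \<subseteq> cball x r"
    by (auto simp: hutchinson_def)
  with r(1) show thesis by (rule that)
qed

text \<open>
  The intersection \<open>A\<close> of the iterates of a trapped ball satisfies \<open>hutchinson G A \<subseteq> A\<close> and
  lies in every iterate of the ball. So every point of \<open>A\<close> is a \<open>k\<close>-letter word applied to
  a point of the ball, and every \<open>k\<close>-letter word maps \<open>A\<close> into \<open>A\<close>; comparing words gives
  the two halves of the estimate on the Hausdorff distance.
\<close>

lemma contractive_attractor_exists:
  fixes G :: "('a::heine_borel \<Rightarrow> 'a) set"
  assumes G: "finite G" "G \<noteq> {}" and lip: "\<And>g. g \<in> G \<Longrightarrow> c-lipschitz_on UNIV g"
    and c: "0 \<le> c" "c < 1"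
  shows "\<exists>A. is_attractor G A"
proof -
  have cont: "\<And>g. g \<in> G \<Longrightarrow> continuous_on UNIV g"
    using lip lipschitz_on_continuous_on by blast
  fix x :: 'a
  obtain r where "0 \<le> r" and trap: "hutchinson G (cball x r) \<subseteq> cball x r"
    using contraction_trapping_ball[OF G(1) lip c] by blast
  define B where "B = cball x r"
  have B: "compact B" "B \<noteq> {}" "hutchinson G B \<subseteq> B"
    unfolding B_def using \<open>0 \<le> r\<close> trap by auto
  let ?H = "\<lambda>k. hutchinson G ^^ k"
  define A where "A = (\<Inter>k. ?H k B)"
  have cpt: "compact (?H k B)" for k by (rule compact_iterate_hutchinson[OF G(1) cont B(1)])
  have "A \<noteq> {}"
    unfolding A_def
    by (rule compact_nest[OF cpt iterate_hutchinson_nonempty[OF G(2) B(2)]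
             iterate_hutchinson_decreasing[OF B(3)]])
  have "compact A"
    unfolding A_def using cpt by (intro compact_Inter) auto
  have A_sub: "A \<subseteq> ?H k B" for k
    unfolding A_def by blast
  have "hutchinson G A \<subseteq> ?H k B" for k
  proof (cases k)
    case 0
    then show ?thesis using hutchinson_mono[OF A_sub[of 0]] B(3) by auto
  next
    case (Suc m)
    then show ?thesis using hutchinson_mono[OF A_sub[of m]] by simp
  qed
  then have "hutchinson G A \<subseteq> A" unfolding A_def by blast
  then have A_inv: "?H k A \<subseteq> A" for k by (rule iterate_hutchinson_subset_self)
  have "(\<lambda>k. hausdorff_dist (?H k K) A) \<longlonglongrightarrow> 0" if K: "compact K" "K \<noteq> {}" for K
  proof -
    have "bounded (K \<union> B)"
      using K(1) B(1) by (simp add: compact_imp_bounded)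
    then obtain D where D: "dist a b \<le> D" if "a \<in> K \<union> B" "b \<in> K \<union> B" for a b
      unfolding bounded_two_points by blast
    have "A \<subseteq> B" using A_sub[of 0] by simp
    have bound: "0 \<le> hausdorff_dist (?H k K) A" "hausdorff_dist (?H k K) A \<le> c ^ k * D" for k
    proof -
      have 1: "infdist a A \<le> c ^ k * D" if a: "a \<in> ?H k K" for a
      proof -
        have "\<exists>y\<in>?H k A. dist a y \<le> c ^ k * D"
          by (rule iterate_hutchinson_close[OF lip c(1) \<open>A \<noteq> {}\<close> _ a])
             (use D \<open>A \<subseteq> B\<close> in auto)
        then show ?thesis using A_inv by (blast intro: infdist_le2)
      qed
      have 2: "infdist b (?H k K) \<le> c ^ k * D" if b: "b \<in> A" for b
      proof -
        have "b \<in> ?H k B" using A_sub b by blast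
        then have "\<exists>y\<in>?H k K. dist b y \<le> c ^ k * D"
          by (rule iterate_hutchinson_close[OF lip c(1) K(2), rotated -1]) (use D in auto)
        then show ?thesis by (blast intro: infdist_le2)
      qed
      show "0 \<le> hausdorff_dist (?H k K) A" "hausdorff_dist (?H k K) A \<le> c ^ k * D"
        using hausdorff_dist_bounded[OF iterate_hutchinson_nonempty[OF G(2) K(2)] \<open>A \<noteq> {}\<close> 1 2]
        by blast+
    qed
    have "(\<lambda>k. c ^ k * D) \<longlonglongrightarrow> 0"
      using c by (auto intro!: tendsto_mult_left_zero LIMSEQ_realpow_zero)
    from tendsto_sandwich[OF _ _ tendsto_const this] show ?thesis
      using bound by (simp add: always_eventually)
  qed
  then show ?thesis
    using \<open>compact A\<close> \<open>A \<noteq> {}\<close> unfolding is_attractor_def by blast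
qed

section \<open>Attractors of zero volume\<close>

lemma iterate_hutchinson_singleton_card:
  assumes "finite G"
  shows "finite ((hutchinson G ^^ k) {x}) \<and> card ((hutchinson G ^^ k) {x}) \<le> card G ^ k"
proof (induction k)
  case (Suc k)
  let ?P = "(hutchinson G ^^ k) {x}"
  have image: "(hutchinson G ^^ Suc k) {x} = (\<lambda>(g, p). g p) ` (G \<times> ?P)"
    by (auto simp: hutchinson_def[of G ?P])
  have "card ((\<lambda>(g, p). g p) ` (G \<times> ?P)) \<le> card G * card ?P"
    using card_image_le[of "G \<times> ?P" "\<lambda>(g, p). g p"] assms Suc
    by (simp add: card_cartesian_product)
  also have "\<dots> \<le> card G ^ Suc k" using Suc by simp
  finally show ?case unfolding image using assms Suc by simp
qed simp

text \<open>
  The centres of the covering balls are the images of the centre of the original ball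
  under the words of length \<open>k\<close>.
\<close>

lemma measure_iterate_hutchinson_cball:
  fixes G :: "('a::euclidean_space \<Rightarrow> 'a) set" and c :: real
  assumes G: "finite G" and lip: "\<And>g. g \<in> G \<Longrightarrow> c-lipschitz_on UNIV g"
    and "0 \<le> c" "0 \<le> r" and "S \<in> lmeasurable" and S: "S \<subseteq> (hutchinson G ^^ k) (cball x r)"
  shows "measure lebesgue S \<le> (real (card G) * c ^ DIM('a)) ^ k * measure lebesgue (cball x r)"
proof -
  define P where "P = (hutchinson G ^^ k) {x}"
  have P: "finite P" "card P \<le> card G ^ k"
    unfolding P_def using iterate_hutchinson_singleton_card[OF G] by blast+
  have ball: "measure lebesgue (cball p (c ^ k * r))
                = (c ^ DIM('a)) ^ k * measure lebesgue (cball x r)" for p :: 'a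
    using \<open>0 \<le> c\<close> \<open>0 \<le> r\<close>
    by (simp add: content_cball power_mult_distrib power_mult[symmetric] mult.commute)
  have "S \<subseteq> (\<Union>p\<in>P. cball p (c ^ k * r))"
  proof
    fix y assume "y \<in> S"
    then have "y \<in> (hutchinson G ^^ k) (cball x r)" using S by blast
    then have "\<exists>p\<in>P. dist y p \<le> c ^ k * r"
      unfolding P_def
      by (rule iterate_hutchinson_close[OF lip \<open>0 \<le> c\<close>, rotated -1]) (auto simp: dist_commute)
    then show "y \<in> (\<Union>p\<in>P. cball p (c ^ k * r))" by (auto simp: dist_commute)
  qed
  then have "measure lebesgue S \<le> measure lebesgue (\<Union>p\<in>P. cball p (c ^ k * r))"
    using \<open>S \<in> lmeasurable\<close> P(1) by (intro measure_mono_fmeasurable lmeasurable_compact compact_UN) auto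
  also have "\<dots> \<le> (\<Sum>p\<in>P. measure lebesgue (cball p (c ^ k * r)))"
    using P(1) by (intro measure_UNION_le) auto
  also have "\<dots> = card P * ((c ^ DIM('a)) ^ k * measure lebesgue (cball x r))"
    by (simp only: ball sum_constant)
  also have "\<dots> \<le> real (card G ^ k) * ((c ^ DIM('a)) ^ k * measure lebesgue (cball x r))"
    using P(2) \<open>0 \<le> c\<close> by (intro mult_right_mono) (simp_all del: of_nat_power)
  finally show ?thesis by (simp add: power_mult_distrib)
qed

lemma attractor_empty_interior:
  fixes G :: "('a::euclidean_space \<Rightarrow> 'a) set" and c :: real
  assumes attr: "is_attractor G A"
    and G: "finite G" "G \<noteq> {}" and lip: "\<And>g. g \<in> G \<Longrightarrow> c-lipschitz_on UNIV g"
    and c: "0 \<le> c" "c < 1" and dim: "real (card G) * c ^ DIM('a) < 1"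
  shows "interior A = {}"
proof -
  let ?s = "real (card G) * c ^ DIM('a)"
  obtain r where r: "0 \<le> r" "hutchinson G (cball 0 r) \<subseteq> cball 0 r"
    using contraction_trapping_ball[OF G(1) lip c] by blast
  have cont: "\<And>g. g \<in> G \<Longrightarrow> continuous_on UNIV g"
    using lip lipschitz_on_continuous_on by blast
  have A: "A \<in> lmeasurable"
    using attr by (auto simp: is_attractor_def lmeasurable_compact)
  have "A \<subseteq> (hutchinson G ^^ k) (cball 0 r)" for k
    by (rule attractor_subset_iterate[OF attr G cont]) (use r in auto)
  then have "measure lebesgue A \<le> ?s ^ k * measure lebesgue (cball (0::'a) r)" for k
    by (intro measure_iterate_hutchinson_cball[OF G(1) lip c(1) r(1) A])
  moreover have "(\<lambda>k. ?s ^ k * measure lebesgue (cball (0::'a) r)) \<longlonglongrightarrow> 0"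
    using c dim by (intro tendsto_mult_left_zero LIMSEQ_realpow_zero) auto
  ultimately have "measure lebesgue A \<le> 0"
    by (intro LIMSEQ_le_const) auto
  then have "negligible A"
    using negligible_iff_measure0[OF A] measure_nonneg[of lebesgue A] by linarith
  then show ?thesis
    using open_not_negligible[OF open_interior] interior_subset negligible_subset by blast
qed

theorem theorem7p1:
  fixes N :: nat
    and f :: "nat \<Rightarrow> real ^ 'd \<Rightarrow> real ^ 'd"
    and q :: "nat \<Rightarrow> real ^ 'd"
  assumes "N \<ge> 2"
    and "\<And>i. i \<in> {1..N} \<Longrightarrow> affine_map (f i)"
  shows "\<exists>\<tau>::real. \<tau> > 0 \<and>
           (\<forall>t. 0 < t \<and> t < \<tau> \<longrightarrow>
              (\<exists>A. is_attractor (affine_family N f q t) A) \<and>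
              (\<forall>A. is_attractor (affine_family N f q t) A \<longrightarrow> interior A = {}))"
proof -
  obtain L :: "nat \<Rightarrow> real ^ 'd ^ 'd" and a :: "nat \<Rightarrow> real ^ 'd"
    where f: "\<And>i x. i \<in> {1..N} \<Longrightarrow> f i x = L i *v x + a i"
    using assms(2) unfolding affine_map_def by metis
  define C where "C = (\<Sum>i=1..N. onorm ((*v) (L i)))"
  have "0 \<le> C" unfolding C_def by (intro sum_nonneg onorm_pos_le) auto
  \<comment> \<open>For \<open>t < \<tau>\<close> the contraction constant \<open>t * C\<close> is below \<open>1 / N\<close>. As the dimension is at
    least \<open>1\<close>, even the first power of the constant makes up for the \<open>N\<close> maps.\<close>
  define \<tau> where "\<tau> = 1 / (N * (C + 1))"
  have "\<tau> > 0" unfolding \<tau>_def using \<open>0 \<le> C\<close> assms(1) by simp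
  moreover have "(\<exists>A. is_attractor (affine_family N f q t) A) \<and>
      (\<forall>A. is_attractor (affine_family N f q t) A \<longrightarrow> interior A = {})"
    if t: "0 < t" "t < \<tau>" for t
  proof -
    define G where "G = affine_family N f q t"
    have G_image: "G = (\<lambda>i x. t *\<^sub>R f i x + q i) ` {1..N}"
      unfolding G_def affine_family_def by blast
    then have G: "finite G" "G \<noteq> {}" using assms(1) by auto
    have card: "card G \<le> N"
      unfolding G_image using card_image_le[of "{1..N}"] by simp
    have "t * (N * (C + 1)) < 1"
      using t(2) \<open>0 \<le> C\<close> assms(1) by (simp add: \<tau>_def pos_less_divide_eq)
    moreover have "0 \<le> t * N" using t(1) by simp
    ultimately have small: "N * (t * C) < 1" by (simp add: algebra_simps)
    have "0 \<le> t * C" using t(1) \<open>0 \<le> C\<close> by simp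
    moreover have "t * C \<le> N * (t * C)"
      using mult_right_mono[of 1 "real N" "t * C"] assms(1) \<open>0 \<le> t * C\<close> by simp
    ultimately have c: "0 \<le> t * C" "t * C < 1" using small by linarith+
    have "(t * C) ^ DIM(real ^ 'd) \<le> t * C"
      using power_decreasing[of 1 "DIM(real ^ 'd)" "t * C"] c by (simp add: Suc_le_eq)
    then have "real (card G) * (t * C) ^ DIM(real ^ 'd) \<le> N * (t * C)"
      using card c(1) by (intro mult_mono) auto
    with small have dim: "real (card G) * (t * C) ^ DIM(real ^ 'd) < 1" by linarith
    have lip: "(t * C)-lipschitz_on UNIV g" if "g \<in> G" for g
    proof (rule lipschitz_onI)
      obtain i where i: "i \<in> {1..N}" and g: "g = (\<lambda>x. t *\<^sub>R f i x + q i)"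
        using \<open>g \<in> G\<close> G_image by blast
      fix x y
      have "onorm ((*v) (L i)) \<le> C"
        unfolding C_def using i by (intro member_le_sum) (auto intro: onorm_pos_le)
      have "g x - g y = t *\<^sub>R (L i *v (x - y))"
        using i by (simp add: g f algebra_simps matrix_vector_mult_diff_distrib)
      then have "dist (g x) (g y) = t * norm (L i *v (x - y))"
        using t(1) by (simp add: dist_norm)
      also have "norm (L i *v (x - y)) \<le> onorm ((*v) (L i)) * norm (x - y)"
        by (intro onorm) simp
      also have "\<dots> \<le> C * norm (x - y)"
        using \<open>onorm ((*v) (L i)) \<le> C\<close> by (simp add: mult_right_mono)
      finally show "dist (g x) (g y) \<le> t * C * dist x y"
        using t(1) by (simp add: dist_norm mult.assoc)
    qed (use c in simp)
    show ?thesis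
      using contractive_attractor_exists[OF G lip c] attractor_empty_interior[OF _ G lip c dim]
      unfolding G_def by blast
  qed
  ultimately show ?thesis by blast
qed

end
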